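(* For dynamic queues, every memoryless randomized online algorithm has competitive ratio at least $\frac{\mathrm{e}}{\mathrm{e}-1}$ against an adaptive-online adversary.
   Context: Dynamic set problem: each item $x$ has a weight $w_x\ge 0$; time proceeds in steps; before each step items may be inserted into or deleted from a dynamic set $\mathcal{S}$; an item is active if inserted and not yet deleted; at each step an algorithm may collect at most one active item it has not collected before (pending items); the gain is the total weight collected. Dynamic queue: $\mathcal{S}$ is a linearly ordered list; items may be inserted at any position, but only a prefix of the current list may be deleted. A randomized algorithm is memoryless if at each step the probability distribution according to which it selects the item to collect depends only on the weights of its currently pending items (in queue order). Adaptive-online adversary: it constructs the instance online, seeing the algorithm's random choices so far, and must also produce its own collection sequence online; a randomized algorithm is $R$-competitive against it if the algorithm's expected gain is at least $1/R$ times the adversary's expected gain, for every such adversary; the competitive ratio is the infimum of such $R$. *)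

theory Defs
  imports "HOL-Probability.Probability"
begin

text \<open>An item is a pair of a unique identifier and a weight.\<close>

type_synonym item = "nat \<times> real"

abbreviation weight :: "item \<Rightarrow> real" where
  "weight x \<equiv> snd x"

text \<open>
  \<open>Insert p w\<close> inserts a new item of weight \<open>w\<close> so that exactly the first \<open>p\<close> items of the list
  precede it (at the end, if the list is shorter than \<open>p\<close>); \<open>Delete_prefix k\<close> deletes the first
  \<open>k\<close> items of the list (all of them, if there are fewer than \<open>k\<close>).
\<close>

datatype update = Insert nat real | Delete_prefix nat

text \<open>The first component of the state is the next unused identifier, so items are never reinserted.\<close>

fun apply_update :: "update \<Rightarrow> nat \<times> item list \<Rightarrow> nat \<times> item list" where
  "apply_update (Insert p w) (n, q) = (Suc n, take p q @ (n, w) # drop p q)"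
| "apply_update (Delete_prefix k) (n, q) = (n, drop k q)"

text \<open>
  The list of active items, given for each step so far the sequence of updates preceding that step.
\<close>

definition active :: "update list list \<Rightarrow> item list" where
  "active uss = snd (fold apply_update (concat uss) (0, []))"

text \<open>
  A collection sequence has one entry per step, \<open>None\<close> meaning that nothing is collected in that
  step.
\<close>

type_synonym collection = "item option list"

definition pending :: "update list list \<Rightarrow> collection \<Rightarrow> item list" where
  "pending uss cs = filter (\<lambda>x. Some x \<notin> set cs) (active uss)"

definition admissible :: "update list list \<Rightarrow> collection \<Rightarrow> item option \<Rightarrow> bool" where
  "admissible uss cs c \<longleftrightarrow> (\<forall>x. c = Some x \<longrightarrow> x \<in> set (pending uss cs))"

definition gain :: "collection \<Rightarrow> real" where
  "gain cs = (\<Sum>c\<leftarrow>cs. case c of None \<Rightarrow> 0 | Some x \<Rightarrow> weight x)"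

text \<open>
  A randomized online algorithm maps the updates revealed so far (including those preceding the
  current step) and its own earlier choices to the distribution of its current choice. Its
  behaviour is constrained on all histories, including those that cannot arise in a play; these
  have no influence on any expected gain, so this is no restriction.
\<close>

type_synonym algorithm = "update list list \<Rightarrow> collection \<Rightarrow> item option pmf"

definition online_algorithm :: "algorithm \<Rightarrow> bool" where
  "online_algorithm A \<longleftrightarrow> (\<forall>uss cs. \<forall>c \<in> set_pmf (A uss cs). admissible uss cs c)"

text \<open>
  For a memoryless algorithm the distribution of the position (in the list of pending items) of
  the selected item is a function \<open>f\<close> of the list of pending weights.
\<close>

definition memoryless :: "algorithm \<Rightarrow> bool" where
  "memoryless A \<longleftrightarrow>
     (\<exists>f :: real list \<Rightarrow> nat option pmf.
        (\<forall>ws. \<forall>i. Some i \<in> set_pmf (f ws) \<longrightarrow> i < length ws) \<and>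
        (\<forall>uss cs. A uss cs =
           map_pmf (map_option (\<lambda>i. pending uss cs ! i)) (f (map weight (pending uss cs)))))"

text \<open>
  An adaptive-online adversary maps the choices made by the algorithm in the earlier steps to the
  updates preceding the current step and to its own choice in the current step. The latter is thus
  made before the algorithm's choice in the same step is known.
\<close>

type_synonym adversary = "collection \<Rightarrow> update list \<times> item option"

text \<open>After the algorithm's choices \<open>cs\<close>, the updates include those preceding the upcoming step.\<close>

definition adv_updates :: "adversary \<Rightarrow> collection \<Rightarrow> update list list" where
  "adv_updates adv cs = map (\<lambda>t. fst (adv (take t cs))) [0..<Suc (length cs)]"

definition adv_choices :: "adversary \<Rightarrow> collection \<Rightarrow> collection" where
  "adv_choices adv cs = map (\<lambda>t. snd (adv (take t cs))) [0..<length cs]"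

definition adaptive_online_adversary :: "adversary \<Rightarrow> bool" where
  "adaptive_online_adversary adv \<longleftrightarrow>
     (\<forall>cs. (\<forall>p w. Insert p w \<in> set (fst (adv cs)) \<longrightarrow> w \<ge> 0) \<and>
           admissible (adv_updates adv cs) (adv_choices adv cs) (snd (adv cs)))"

text \<open>Distribution of the choices made by the algorithm in the first \<open>T\<close> steps.\<close>

primrec play :: "algorithm \<Rightarrow> adversary \<Rightarrow> nat \<Rightarrow> collection pmf" where
  "play A adv 0 = return_pmf []"
| "play A adv (Suc T) =
     bind_pmf (play A adv T) (\<lambda>cs.
       map_pmf (\<lambda>c. cs @ [c]) (A (adv_updates adv cs) cs))"

text \<open>
  For an online algorithm the distribution \<open>play A adv T\<close> has finite support, so that both
  expectations below exist.
\<close>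

definition alg_expected_gain :: "algorithm \<Rightarrow> adversary \<Rightarrow> nat \<Rightarrow> real" where
  "alg_expected_gain A adv T = measure_pmf.expectation (play A adv T) gain"

definition adv_expected_gain :: "algorithm \<Rightarrow> adversary \<Rightarrow> nat \<Rightarrow> real" where
  "adv_expected_gain A adv T =
     measure_pmf.expectation (play A adv T) (\<lambda>cs. gain (adv_choices adv cs))"

text \<open>
  The number of steps \<open>T\<close> is chosen by the adversary. Stopping early, depending on the history,
  amounts to deleting the whole list and inserting nothing afterwards.
\<close>

definition competitive :: "real \<Rightarrow> algorithm \<Rightarrow> bool" where
  "competitive R A \<longleftrightarrow>
     (\<forall>adv T. adaptive_online_adversary adv \<longrightarrow>
        alg_expected_gain A adv T \<ge> 1 / R * adv_expected_gain A adv T)"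

text \<open>The ratio is \<open>\<infinity>\<close> if the algorithm is not competitive for any \<open>R\<close>.\<close>

definition competitive_ratio :: "algorithm \<Rightarrow> ereal" where
  "competitive_ratio A = Inf {ereal R | R. R > 0 \<and> competitive R A}"

end

theory Submission
  imports Defs
begin

text \<open>
  Against an adversary with parameter \<open>k\<close> the pending items of the algorithm always have the same
  weights \<open>w\<^sub>0, \<dots>, w\<^sub>n\<close>. In each step the adversary collects the item of weight \<open>w\<^sub>k\<close>, deletes the
  prefix up to this item and inserts it afresh; if the algorithm collected an item behind position
  \<open>k\<close>, a copy of it is inserted, while the original stays in the queue and is collected by the
  adversary at the end. If a memoryless algorithm selects position \<open>i\<close> with probability \<open>p\<^sub>i\<close>, its gain
  per step is \<open>G = \<Sum>i. p\<^sub>i w\<^sub>i\<close>, and that of the adversary is \<open>w\<^sub>k + (\<Sum>i>k. p\<^sub>i w\<^sub>i) \<le> R G\<close>. For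
  \<open>b = 1 - 1/n\<close> and \<open>w\<^sub>i = b\<^sup>-\<^sup>i\<close>, adding up these inequalities for \<open>k < n\<close> with coefficients \<open>b\<^sup>k / n\<close>
  yields \<open>G \<le> R (1 - b\<^sup>n) G\<close>, where \<open>b\<^sup>n\<close> tends to \<open>1 / e\<close>.
\<close>

section \<open>Histories, gains and expectations of a play\<close>

lemma adv_updates_snoc:
  "adv_updates adv (cs @ [c]) = adv_updates adv cs @ [fst (adv (cs @ [c]))]"
  by (simp add: adv_updates_def)

lemma adv_choices_snoc:
  "adv_choices adv (cs @ [c]) = adv_choices adv cs @ [snd (adv cs)]"
  by (simp add: adv_choices_def)

abbreviation payoff :: "item option \<Rightarrow> real" where
  "payoff c \<equiv> case c of None \<Rightarrow> 0 | Some x \<Rightarrow> weight x"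

lemma gain_snoc: "gain (cs @ [c]) = gain cs + payoff c"
  by (simp add: gain_def)

lemma sum_list_filter_neq_le:
  fixes g :: "'a \<Rightarrow> real"
  assumes "\<And>y. y \<in> set xs \<Longrightarrow> 0 \<le> g y"
  shows "sum_list (map g (filter (\<lambda>y. y \<noteq> x) xs)) + (if x \<in> set xs then g x else 0) \<le>
    sum_list (map g xs)"
  using assms by (induction xs) (force split: if_splits)+

lemma length_play: "cs \<in> set_pmf (play A adv T) \<Longrightarrow> length cs = T"
  by (induction T arbitrary: cs) (auto simp: set_bind_pmf)

lemma admissible_finite: "finite {c. admissible uss cs c}"
proof (rule finite_subset)
  show "{c. admissible uss cs c} \<subseteq> insert None (Some ` set (pending uss cs))"
  proof
    fix c assume "c \<in> {c. admissible uss cs c}"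
    then show "c \<in> insert None (Some ` set (pending uss cs))"
      by (cases c) (auto simp: admissible_def)
  qed
qed simp

lemma finite_set_pmf_online:
  assumes "online_algorithm A"
  shows "finite (set_pmf (A uss cs))"
  using assms unfolding online_algorithm_def
  by (intro finite_subset[OF _ admissible_finite[of uss cs]]) auto

lemma finite_play:
  assumes "online_algorithm A"
  shows "finite (set_pmf (play A adv T))"
  by (induction T) (auto simp: set_bind_pmf finite_set_pmf_online[OF assms])

text \<open>Each further step appends an entry that truncation discards again. This reduces
  expectations after \<open>T + L\<close> steps to expectations after \<open>T\<close> steps, for
  quantities that are determined by the first \<open>T\<close> choices.\<close>

lemma map_take_play: "map_pmf (take T) (play A adv (T + L)) = play A adv T"
proof (induction L)
  case 0
  have "map_pmf (take T) (play A adv T) = map_pmf id (play A adv T)"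
    by (intro map_pmf_cong) (auto dest: length_play)
  then show ?case by simp
next
  case (Suc L)
  have "map_pmf (take T) (play A adv (T + Suc L)) =
      play A adv (T + L) \<bind> (\<lambda>cs. return_pmf (take T cs))"
    by (auto simp: map_bind_pmf map_pmf_comp o_def intro!: bind_pmf_cong dest: length_play)
  also have "\<dots> = play A adv T"
    using Suc by (simp add: map_pmf_def)
  finally show ?case .
qed

lemma expectation_play_Suc:
  fixes h :: "collection \<Rightarrow> real"
  assumes "online_algorithm A"
  shows "measure_pmf.expectation (play A adv (Suc T)) h =
    measure_pmf.expectation (play A adv T)
      (\<lambda>cs. measure_pmf.expectation (A (adv_updates adv cs) cs) (\<lambda>c. h (cs @ [c])))"
  unfolding play.simps
  by (subst pmf_expectation_bind[where A = "set_pmf (play A adv T)"])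
    (auto simp: finite_play[OF assms] finite_set_pmf_online[OF assms]
      integral_measure_pmf_real[where A = "set_pmf (play A adv T)"] mult.commute)

text \<open>A drift argument: a quantity with constant conditional drift \<open>d\<close> grows
  linearly in expectation. The drift is required on reachable histories only, which is where the
  pending weights are known. It is applied to the algorithm's gain and to the total weight of the
  queue.\<close>

lemma expectation_play_linear:
  fixes h :: "collection \<Rightarrow> real"
  assumes "online_algorithm A"
    and step: "\<And>t cs. t < T \<Longrightarrow> cs \<in> set_pmf (play A adv t) \<Longrightarrow>
      measure_pmf.expectation (A (adv_updates adv cs) cs) (\<lambda>c. h (cs @ [c])) = h cs + d"
  shows "measure_pmf.expectation (play A adv T) h = h [] + real T * d"
  using step
proof (induction T)
  case (Suc T)
  have "measure_pmf.expectation (play A adv (Suc T)) h =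
      measure_pmf.expectation (play A adv T) (\<lambda>cs. h cs + d)"
    unfolding expectation_play_Suc[OF assms(1)]
    using Suc.prems by (intro integral_cong_AE) (auto simp: AE_measure_pmf_iff)
  also have "\<dots> = measure_pmf.expectation (play A adv T) h + d"
    by (simp add: integrable_measure_pmf_finite finite_play[OF assms(1)])
  also have "measure_pmf.expectation (play A adv T) h = h [] + real T * d"
    by (rule Suc.IH) (rule Suc.prems, auto)
  finally show ?case by (simp add: algebra_simps)
qed simp

section \<open>Duplicating a collected item and refilling the front of the queue\<close>

text \<open>The copy, with identifier \<open>m\<close>, is placed immediately before the original.\<close>

definition duplicate :: "nat \<Rightarrow> item option \<Rightarrow> item list \<Rightarrow> item list" where
  "duplicate m c q = (case c of
     Some x \<Rightarrow> if x \<in> set q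
       then takeWhile (\<lambda>y. y \<noteq> x) q @ (m, weight x) # dropWhile (\<lambda>y. y \<noteq> x) q else q
   | None \<Rightarrow> q)"

lemma duplicate_notin: "(\<And>x. c = Some x \<Longrightarrow> x \<notin> set q) \<Longrightarrow> duplicate m c q = q"
  by (auto simp: duplicate_def split: option.split)

lemma duplicate_split:
  assumes "x \<in> set q"
  obtains l r where "q = l @ x # r" "x \<notin> set l"
    "duplicate m (Some x) q = l @ (m, weight x) # x # r"
proof -
  obtain l r where "q = l @ x # r" "x \<notin> set l"
    using split_list_first[OF assms] by blast
  moreover from this have "takeWhile (\<lambda>y. y \<noteq> x) q = l" "dropWhile (\<lambda>y. y \<noteq> x) q = x # r"
    by (auto simp: takeWhile_append dropWhile_append)
  ultimately show ?thesis
    using that assms by (simp add: duplicate_def)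
qed

lemma duplicate_cases:
  obtains (same) "\<And>x. c = Some x \<Longrightarrow> x \<notin> set q" "duplicate m c q = q"
  | (new) x l r where "c = Some x" "q = l @ x # r" "x \<notin> set l"
      "duplicate m c q = l @ (m, weight x) # x # r"
proof (cases "\<exists>x. c = Some x \<and> x \<in> set q")
  case True
  then show ?thesis using new duplicate_split by metis
next
  case False
  then show ?thesis using same duplicate_notin by metis
qed

lemma length_duplicate: "length (duplicate m c q) \<le> Suc (length q)"
  by (cases rule: duplicate_cases[where c = c and q = q and m = m]) auto

lemma set_duplicate:
  "x \<in> set (duplicate m c q) \<Longrightarrow> x \<in> set q \<or> fst x = m \<and> weight x \<in> weight ` set q"
  by (cases rule: duplicate_cases[where c = c and q = q and m = m]) auto

lemma distinct_duplicate:
  "distinct (map fst q) \<Longrightarrow> \<forall>x\<in>set q. fst x < m \<Longrightarrow> distinct (map fst (duplicate m c q))"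
proof (cases rule: duplicate_cases[where c = c and q = q and m = m])
  case (new x l r)
  assume *: "distinct (map fst q)" "\<forall>x\<in>set q. fst x < m"
  from *(2) have "m \<notin> fst ` set q" by auto
  with * new show ?thesis by auto
qed auto

lemma sum_list_duplicate:
  "sum_list (map weight (duplicate m c q)) = sum_list (map weight q) +
     (case c of Some x \<Rightarrow> if x \<in> set q then weight x else 0 | None \<Rightarrow> 0)"
  by (cases rule: duplicate_cases[where c = c and q = q and m = m]) (auto split: option.split)

text \<open>The original \<open>x\<close> was still pending and drops out, while the copy, of equal
  weight, takes over its place. The bound on the identifiers in \<open>cs\<close> ensures that the
  copy itself does not count as collected.\<close>

lemma pending_duplicate:
  assumes "distinct q" and "\<And>x. Some x \<in> set cs \<Longrightarrow> fst x < m" and "\<forall>x\<in>set q. fst x < m"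
    and "\<And>x. c = Some x \<Longrightarrow> c \<notin> set cs"
  shows "map weight (filter (\<lambda>x. Some x \<notin> set (cs @ [c])) (duplicate m c q)) =
    map weight (filter (\<lambda>x. Some x \<notin> set cs) q)"
proof (cases rule: duplicate_cases[where c = c and q = q and m = m])
  case same
  then show ?thesis
    by (auto intro!: arg_cong[where f = "map weight"] filter_cong)
next
  case (new x l r)
  have *: "filter (\<lambda>y. Some y \<notin> set (cs @ [c])) l' = filter (\<lambda>y. Some y \<notin> set cs) l'"
    if "x \<notin> set l'" for l'
    using new that by (intro filter_cong) auto
  have "x \<notin> set r" "fst x < m" "Some x \<notin> set cs"
    using assms new by auto
  moreover have "Some (m, weight x) \<notin> set cs"
    using assms(2)[of "(m, weight x)"] by auto
  moreover from \<open>fst x < m\<close> have "x \<noteq> (m, weight x)"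
    by (cases x) auto
  ultimately show ?thesis
    using *[of l] *[of r] new by auto
qed

lemma fold_Insert_0:
  "fold apply_update (map (Insert 0) vs) (m, q) =
     (m + length vs, rev (zip [m..<m + length vs] vs) @ q)"
proof (induction vs arbitrary: m q)
  case (Cons v vs)
  have "[m..<m + length (v # vs)] = m # [Suc m..<Suc m + length vs]"
    by (subst upt_conv_Cons) auto
  then show ?case by (simp add: Cons del: upt_Suc)
qed simp

text \<open>Repeated insertion at position 0 reverses the order, hence the
  \<open>rev\<close>.\<close>

lemma insert_front:
  obtains pre where "fold apply_update (map (Insert 0) (rev vs)) (m, q) = (m + length vs, pre @ q)"
    "map weight pre = vs" "distinct (map fst pre)"
    "\<And>x. x \<in> set pre \<Longrightarrow> m \<le> fst x \<and> fst x < m + length vs"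
proof -
  let ?pre = "rev (zip [m..<m + length vs] (rev vs))"
  have "map fst ?pre = rev [m..<m + length vs]" "map weight ?pre = vs"
    by (simp_all add: rev_map[symmetric])
  moreover have "m \<le> fst x \<and> fst x < m + length vs" if "x \<in> set ?pre" for x
    using that set_zip_leftD[of "fst x" "weight x"] unfolding set_rev by fastforce
  ultimately show ?thesis
    using that[of ?pre] by (simp add: fold_Insert_0)
qed

section \<open>Expected weights per step\<close>

definition alg_rate :: "real list \<Rightarrow> nat option pmf \<Rightarrow> real" where
  "alg_rate ws p = measure_pmf.expectation p (\<lambda>j. case j of None \<Rightarrow> 0 | Some i \<Rightarrow> ws ! i)"

text \<open>For \<open>ws\<close> and \<open>p\<close> as in the introduction this is the sum of
  \<open>p\<^sub>i w\<^sub>i\<close> over \<open>i > k\<close>, the expected weight by which the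
  queue grows in a step.\<close>

definition duplicate_rate :: "real list \<Rightarrow> nat \<Rightarrow> nat option pmf \<Rightarrow> real" where
  "duplicate_rate ws k p = measure_pmf.expectation p
     (\<lambda>j. case j of None \<Rightarrow> 0 | Some i \<Rightarrow> if k < i then ws ! i else 0)"

section \<open>The adversary's queue and its evolution\<close>

locale duplication =
  fixes ws :: "real list" and k :: nat
  assumes k_less: "k < length ws" and nonneg: "\<And>w. w \<in> set ws \<Longrightarrow> 0 \<le> w"
begin

text \<open>Positions count from 0, so deleting up to position \<open>k\<close> removes
  \<open>Suc k\<close> items. The copy is inserted after the deletion and before the refill, so its
  position refers to \<open>drop (Suc k) q\<close>; this is a position among the active items,
  including those the algorithm has already collected. A choice in the deleted prefix needs no copy,
  since the refill replaces it.\<close>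

definition response :: "item list \<Rightarrow> item option \<Rightarrow> update list" where
  "response q c = Delete_prefix (Suc k) #
     (case c of
        Some x \<Rightarrow> if x \<in> set (drop (Suc k) q)
          then [Insert (length (takeWhile (\<lambda>y. y \<noteq> x) (drop (Suc k) q))) (weight x)] else []
      | None \<Rightarrow> []) @
     map (Insert 0) (rev (take (Suc k) ws))"

text \<open>The histories in \<open>state_rev\<close> are reversed, the latest choice being the head.\<close>

primrec state_rev :: "collection \<Rightarrow> nat \<times> item list" where
  "state_rev [] = fold apply_update (map (Insert 0) (rev ws)) (0, [])"
| "state_rev (c # cs) =
     fold apply_update (response (snd (state_rev cs)) c) (state_rev cs)"

definition state :: "collection \<Rightarrow> nat \<times> item list" where
  "state cs = state_rev (rev cs)"

abbreviation "counter cs \<equiv> fst (state cs)"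
abbreviation "queue cs \<equiv> snd (state cs)"

lemma state_simps:
  "state [] = fold apply_update (map (Insert 0) (rev ws)) (0, [])"
  "state (cs @ [c]) = fold apply_update (response (queue cs) c) (state cs)"
  by (simp_all add: state_def)

definition updates :: "collection \<Rightarrow> update list" where
  "updates cs = (if cs = [] then map (Insert 0) (rev ws)
     else response (queue (butlast cs)) (last cs))"

text \<open>
  After \<open>T\<close> steps the queue does not change any more, and the adversary collects it from the front.
\<close>

definition adversary :: "nat \<Rightarrow> adversary" where
  "adversary T cs =
     (if length cs \<le> T then updates cs else [],
      if length cs < T then Some (queue cs ! k)
      else if length cs - T < length (queue (take T cs))
      then Some (queue (take T cs) ! (length cs - T))
      else None)"

text \<open>A normal form of the new queue that covers steps with and without a copy. The number
  \<open>n\<close> is the next free identifier at the moment the refill begins; it separates the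
  identifiers of the refill \<open>pre\<close> from all those behind it.\<close>

lemma state_snoc:
  obtains pre n where
    "queue (cs @ [c]) = pre @ duplicate (counter cs) c (drop (Suc k) (queue cs))"
    "map weight pre = take (Suc k) ws" "distinct (map fst pre)"
    "\<And>x. x \<in> set pre \<Longrightarrow> n \<le> fst x \<and> fst x < counter (cs @ [c])"
    "\<And>x. x \<in> set (duplicate (counter cs) c (drop (Suc k) (queue cs))) \<Longrightarrow>
       x \<in> set (drop (Suc k) (queue cs)) \<or>
       fst x = counter cs \<and> fst x < n \<and> weight x \<in> weight ` set (drop (Suc k) (queue cs))"
    "counter cs \<le> n" "n < counter (cs @ [c])"
proof -
  obtain m q where mq: "state cs = (m, q)" by (cases "state cs")
  let ?vs = "take (Suc k) ws" and ?q = "drop (Suc k) q"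
  obtain n where st: "state (cs @ [c]) =
        fold apply_update (map (Insert 0) (rev ?vs)) (n, duplicate m c ?q)"
      and n: "m \<le> n" "duplicate m c ?q = ?q \<or> m < n"
  proof (cases "\<exists>x. c = Some x \<and> x \<in> set ?q")
    case True
    then obtain x where x: "c = Some x" "x \<in> set ?q" by blast
    have "state (cs @ [c]) =
        fold apply_update (map (Insert 0) (rev ?vs)) (Suc m, duplicate m c ?q)"
      using x takeWhile_eq_take[of "\<lambda>y. y \<noteq> x" ?q] dropWhile_eq_drop[of "\<lambda>y. y \<noteq> x" ?q]
      by (simp add: state_simps mq response_def duplicate_def del: drop_drop)
    then show ?thesis
      using that[of "Suc m"] by simp
  next
    case False
    then show ?thesis
      using that[of m]
      by (auto simp: state_simps mq response_def duplicate_def split: option.split)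
  qed
  obtain pre where "fold apply_update (map (Insert 0) (rev ?vs)) (n, duplicate m c ?q) =
        (n + length ?vs, pre @ duplicate m c ?q)"
      "map weight pre = ?vs" "distinct (map fst pre)"
      "\<And>x. x \<in> set pre \<Longrightarrow> n \<le> fst x \<and> fst x < n + length ?vs"
    using insert_front[of ?vs n "duplicate m c ?q"] by blast
  moreover have "x \<in> set ?q \<or> fst x = m \<and> fst x < n \<and> weight x \<in> weight ` set ?q"
    if "x \<in> set (duplicate m c ?q)" for x
    using set_duplicate[OF that] n that by auto
  ultimately show ?thesis
    using that[of pre n] n(1) st k_less by (simp add: mq)
qed

text \<open>A joint induction: distinctness of the new queue rests on the identifier bound for the
  old one, and a copy inherits the nonnegative weight of its original.\<close>

lemma queue_invariant:
  "Suc k \<le> length (queue cs) \<and> map weight (take (Suc k) (queue cs)) = take (Suc k) ws \<and>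
   distinct (map fst (queue cs)) \<and> (\<forall>x\<in>set (queue cs). fst x < counter cs \<and> 0 \<le> weight x)"
proof (induction cs rule: rev_induct)
  case Nil
  obtain pre where "state [] = (0 + length ws, pre @ [])" "map weight pre = ws"
      "distinct (map fst pre)" "\<And>x. x \<in> set pre \<Longrightarrow> 0 \<le> fst x \<and> fst x < 0 + length ws"
    unfolding state_simps using insert_front[of ws 0 "[]"] by blast
  moreover from this have "0 \<le> weight x" if "x \<in> set pre" for x
    using that nonneg[of "weight x"] by auto
  ultimately show ?case
    using k_less by (auto simp: take_map[symmetric])
next
  case (snoc c cs)
  let ?q = "drop (Suc k) (queue cs)"
  have q: "distinct (map fst ?q)" "\<forall>x\<in>set ?q. fst x < counter cs \<and> 0 \<le> weight x"
    using snoc by (auto simp: drop_map[symmetric] dest: in_set_dropD)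
  obtain pre n where pre:
    "queue (cs @ [c]) = pre @ duplicate (counter cs) c ?q"
    "map weight pre = take (Suc k) ws" "distinct (map fst pre)"
    "\<And>x. x \<in> set pre \<Longrightarrow> n \<le> fst x \<and> fst x < counter (cs @ [c])"
    "\<And>x. x \<in> set (duplicate (counter cs) c ?q) \<Longrightarrow>
       x \<in> set ?q \<or> fst x = counter cs \<and> fst x < n \<and> weight x \<in> weight ` set ?q"
    "counter cs \<le> n" "n < counter (cs @ [c])"
    using state_snoc[of cs c] by blast
  have len: "length pre = Suc k"
    using arg_cong[OF pre(2), of length] k_less by simp
  have dup: "fst x < n \<and> 0 \<le> weight x" if "x \<in> set (duplicate (counter cs) c ?q)" for x
    using pre(5)[OF that] q(2) pre(6) by force
  have "0 \<le> weight x" if "x \<in> set pre" for x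
  proof -
    have "weight x \<in> set (take (Suc k) ws)"
      using that unfolding pre(2)[symmetric] by auto
    then show ?thesis by (auto intro: nonneg dest: in_set_takeD)
  qed
  moreover have "fst ` set pre \<inter> fst ` set (duplicate (counter cs) c ?q) = {}"
    using pre(4) dup by fastforce
  moreover have "distinct (map fst (duplicate (counter cs) c ?q))"
    using q by (intro distinct_duplicate) auto
  moreover have "fst x < counter (cs @ [c])" if "x \<in> set (queue (cs @ [c]))" for x
    using that pre(4)[of x] pre(7) dup[of x] unfolding pre(1) by auto
  ultimately show ?case
    using pre(2,3) len dup unfolding pre(1) by auto
qed

lemma
  shows length_queue: "Suc k \<le> length (queue cs)"
    and weight_take_queue: "map weight (take (Suc k) (queue cs)) = take (Suc k) ws"
    and distinct_fst_queue: "distinct (map fst (queue cs))"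
    and fst_queue: "x \<in> set (queue cs) \<Longrightarrow> fst x < counter cs"
    and weight_queue: "x \<in> set (queue cs) \<Longrightarrow> 0 \<le> weight x"
  using queue_invariant[of cs] by auto

lemma distinct_queue: "distinct (queue cs)"
  using distinct_fst_queue distinct_map by blast

lemma queue_nth_k: "queue cs ! k \<in> set (queue cs)" "weight (queue cs ! k) = ws ! k"
proof -
  show "queue cs ! k \<in> set (queue cs)"
    using length_queue[of cs] by simp
  have "weight (queue cs ! k) = map weight (take (Suc k) (queue cs)) ! k"
    using length_queue[of cs] by simp
  then show "weight (queue cs ! k) = ws ! k"
    using k_less by (simp add: weight_take_queue)
qed

lemma queue_nth_k_notin_drop: "queue cs ! k \<notin> set (drop (Suc k) (queue cs))"
proof -
  have "queue cs ! k \<in> set (take (Suc k) (queue cs))"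
    using length_queue[of cs] by (auto simp: in_set_conv_nth intro!: exI[of _ k])
  then show ?thesis
    using set_take_disj_set_drop_if_distinct[OF distinct_queue, of "Suc k" "Suc k" cs] by blast
qed

lemma counter_mono: "counter cs \<le> counter (cs @ [c])"
proof -
  obtain n where "counter cs \<le> n" "n < counter (cs @ [c])"
    by (rule state_snoc[of cs c])
  then show ?thesis by simp
qed

text \<open>Whatever a step inserts has an identifier not below the old counter, so an item with a
  smaller identifier cannot return once deleted.\<close>

lemma set_queue_snoc:
  assumes "x \<in> set (queue (cs @ [c]))"
  shows "x \<in> set (drop (Suc k) (queue cs)) \<or> counter cs \<le> fst x"
proof (rule state_snoc[of cs c], goal_cases)
  case (1 pre n)
  show ?thesis
  proof (cases "x \<in> set pre")
    case True
    then show ?thesis using 1(4)[of x] 1(6) by simp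
  next
    case False
    then show ?thesis using assms 1(5)[of x] by (auto simp: 1(1))
  qed
qed

text \<open>The refill restores the weights of the deleted prefix, so only a copy changes the total.
  Items collected by the algorithm still count here, because the adversary has not collected
  them.\<close>

lemma sum_list_queue_snoc:
  "sum_list (map weight (queue (cs @ [c]))) = sum_list (map weight (queue cs)) +
     (case c of Some x \<Rightarrow> if x \<in> set (drop (Suc k) (queue cs)) then weight x else 0 | None \<Rightarrow> 0)"
proof -
  have "sum_list (map weight (queue cs)) =
      sum_list (map weight (take (Suc k) (queue cs))) + sum_list (map weight (drop (Suc k) (queue cs)))"
    by (metis append_take_drop_id map_append sum_list_append)
  then show ?thesis
    by (rule_tac state_snoc[of cs c]) (simp add: sum_list_duplicate weight_take_queue)
qed

text \<open>The queue gains at most one item, the copy, per step. The bound tells how many final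
  steps suffice for the adversary to collect the whole queue.\<close>

lemma length_queue_le: "length (queue cs) \<le> length ws + length cs"
proof (induction cs rule: rev_induct)
  case Nil
  show ?case by (rule insert_front[of ws 0 "[]"]) (auto simp: state_simps)
next
  case (snoc c cs)
  obtain pre where "queue (cs @ [c]) = pre @ duplicate (counter cs) c (drop (Suc k) (queue cs))"
      "map weight pre = take (Suc k) ws"
    by (rule state_snoc[of cs c])
  moreover from arg_cong[OF this(2), of length] have "length pre = Suc k"
    using k_less by simp
  ultimately show ?case
    using length_duplicate[of "counter cs" c "drop (Suc k) (queue cs)"] length_queue[of cs] snoc
    by simp
qed

section \<open>Legality and gain of the adversary's own collection\<close>

lemma active_adversary:
  "active (adv_updates (adversary T) cs) = queue (take T cs)"
proof -
  have "fold apply_update (concat (adv_updates (adversary T) cs)) (0, []) = state (take T cs)"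
  proof (induction cs rule: rev_induct)
    case Nil
    then show ?case by (simp add: adv_updates_def adversary_def updates_def state_simps)
  next
    case (snoc c cs)
    then show ?case
      by (auto simp: adv_updates_snoc adversary_def updates_def state_simps)
  qed
  then show ?thesis by (simp add: active_def)
qed

text \<open>
  The bound on the identifier makes the induction work: it excludes that the item is inserted later.
\<close>

lemma collected_early:
  assumes "t < t'" "t' \<le> length cs"
  shows "queue (take t cs) ! k \<notin> set (queue (take t' cs)) \<and>
    fst (queue (take t cs) ! k) < counter (take t' cs)"
  using assms
proof (induction t')
  case (Suc t')
  let ?x = "queue (take t cs) ! k"
  have eq: "take (Suc t') cs = take t' cs @ [cs ! t']"
    using Suc.prems by (simp add: take_Suc_conv_app_nth)
  have "?x \<notin> set (drop (Suc k) (queue (take t' cs))) \<and> fst ?x < counter (take t' cs)"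
  proof (cases "t = t'")
    case True
    then show ?thesis
      using queue_nth_k_notin_drop fst_queue[OF queue_nth_k(1)] by simp
  next
    case False
    then show ?thesis using Suc by (auto dest: in_set_dropD)
  qed
  then show ?case
    using set_queue_snoc[of ?x "take t' cs" "cs ! t'"] counter_mono[of "take t' cs" "cs ! t'"]
    unfolding eq by linarith
qed simp

lemma pending_adversary:
  "pending (adv_updates (adversary T) cs) cs' =
     filter (\<lambda>x. Some x \<notin> set cs') (queue (take T cs))"
  by (simp add: pending_def active_adversary)

lemma Some_in_adv_choices:
  assumes "Some x \<in> set (adv_choices (adversary T) cs)"
  obtains t where "t < length cs" "t < T" "x = queue (take t cs) ! k"
  | t where "t < length cs" "T \<le> t" "t - T < length (queue (take T cs))"
      "x = queue (take T cs) ! (t - T)"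
proof -
  obtain t where "t < length cs" "Some x = snd (adversary T (take t cs))"
    using assms by (auto simp: adv_choices_def)
  then show ?thesis
    using that by (auto simp: adversary_def min_def split: if_splits)
qed

lemma adaptive_online_adversary: "adaptive_online_adversary (adversary T)"
  unfolding adaptive_online_adversary_def
proof (intro allI conjI impI)
  fix cs p w
  assume "Insert p w \<in> set (fst (adversary T cs))"
  then have "Insert p w \<in> set (updates cs)"
    by (auto simp: adversary_def split: if_splits)
  then have "w \<in> set ws \<or> (\<exists>x. x \<in> set (queue (butlast cs)) \<and> w = weight x)"
    by (auto simp: updates_def response_def split: if_splits option.splits
        dest: in_set_takeD in_set_dropD)
  then show "0 \<le> w"
    using nonneg weight_queue by blast
next
  fix cs
  let ?q = "queue (take T cs)"
  \<comment> \<open>The queue in question is the one at time \<open>min T (length cs)\<close>. Thus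
    the fact serves both phases: items taken at position \<open>k\<close> are missing from the later
    queues and from the final one.\<close>
  have early: "queue (take t cs) ! k \<notin> set ?q" if "t < length cs" "t < T" for t
    using that collected_early[of t "min T (length cs)" cs] by (cases "T \<le> length cs") auto
  have "x \<in> set ?q \<and> Some x \<notin> set (adv_choices (adversary T) cs)"
    if x: "snd (adversary T cs) = Some x" for x
  proof (cases "length cs < T")
    case True
    then have "x \<in> set ?q"
      using x queue_nth_k(1)[of cs] by (auto simp: adversary_def)
    then show ?thesis
      using early True by (auto elim!: Some_in_adv_choices)
  next
    case False
    then have s: "length cs - T < length ?q" "x = ?q ! (length cs - T)"
      using x by (auto simp: adversary_def split: if_splits)
    moreover have "x \<noteq> ?q ! (t - T)" if "t < length cs" "T \<le> t" for t
      using that s distinct_queue[of "take T cs"] by (simp add: nth_eq_iff_index_eq)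
    moreover have "x \<in> set ?q"
      using s by simp
    ultimately show ?thesis
      using early by (metis Some_in_adv_choices)
  qed
  then show "admissible (adv_updates (adversary T) cs) (adv_choices (adversary T) cs)
      (snd (adversary T cs))"
    by (auto simp: admissible_def pending_adversary)
qed

lemma gain_adv_choices:
  "gain (adv_choices (adversary T) cs) = real (min T (length cs)) * ws ! k +
     sum_list (map weight (take (length cs - T) (queue (take T cs))))"
proof (induction cs rule: rev_induct)
  case Nil
  then show ?case by (simp add: adv_choices_def gain_def)
next
  case (snoc c cs)
  show ?case
  proof (cases "length cs < T")
    case True
    then show ?thesis
      using snoc queue_nth_k(2)[of cs]
      by (simp add: adv_choices_snoc gain_snoc adversary_def algebra_simps)
  next
    case False
    then show ?thesis
      using snoc
      by (auto simp: adv_choices_snoc gain_snoc adversary_def Suc_diff_le take_Suc_conv_app_nth)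
  qed
qed

lemma weight_queue_Nil: "map weight (queue []) = ws"
  by (rule insert_front[of ws 0 "[]"]) (simp add: state_simps)

lemma take_drop_queue_snoc:
  assumes "queue (cs @ [c]) = pre @ q" "map weight pre = take (Suc k) ws"
  shows "take (Suc k) (queue (cs @ [c])) = pre" "drop (Suc k) (queue (cs @ [c])) = q"
proof -
  have "length pre = Suc k"
    using arg_cong[OF assms(2), of length] k_less by simp
  then show "take (Suc k) (queue (cs @ [c])) = pre" "drop (Suc k) (queue (cs @ [c])) = q"
    using assms(1) by simp_all
qed

section \<open>The algorithm against this adversary\<close>

context
  fixes A :: algorithm and T :: nat
  assumes online: "online_algorithm A"
begin

lemma collected_pending:
  assumes "Some x \<in> set_pmf (A (adv_updates (adversary T) cs) cs)"
  shows "x \<in> set (queue (take T cs))" "Some x \<notin> set cs"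
proof -
  have "admissible (adv_updates (adversary T) cs) cs (Some x)"
    using assms online unfolding online_algorithm_def by blast
  then show "x \<in> set (queue (take T cs))" "Some x \<notin> set cs"
    by (simp_all add: admissible_def pending_adversary)
qed

text \<open>Up to time \<open>T\<close> the algorithm always faces the weights \<open>ws\<close>:
  the refilled prefix is entirely uncollected, and behind it every collected original is compensated
  by its copy. The identifier bound on collected items carries the induction, as it shows that newly
  inserted items are uncollected.\<close>

lemma play_invariant:
  assumes "cs \<in> set_pmf (play A (adversary T) t)" "t \<le> T"
  shows "(\<forall>x. Some x \<in> set cs \<longrightarrow> fst x < counter cs) \<and>
    (\<forall>x\<in>set (take (Suc k) (queue cs)). Some x \<notin> set cs) \<and>
    map weight (filter (\<lambda>x. Some x \<notin> set cs) (drop (Suc k) (queue cs))) = drop (Suc k) ws"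
  using assms
proof (induction t arbitrary: cs)
  case 0
  then show ?case
    using weight_queue_Nil by (simp add: drop_map[symmetric])
next
  case (Suc t)
  then obtain cs' c where cs: "cs = cs' @ [c]" and cs': "cs' \<in> set_pmf (play A (adversary T) t)"
    and c: "c \<in> set_pmf (A (adv_updates (adversary T) cs') cs')"
    by (auto simp: set_bind_pmf)
  let ?q = "drop (Suc k) (queue cs')"
  have IH: "\<And>x. Some x \<in> set cs' \<Longrightarrow> fst x < counter cs'"
    "\<And>x. x \<in> set (take (Suc k) (queue cs')) \<Longrightarrow> Some x \<notin> set cs'"
    "map weight (filter (\<lambda>x. Some x \<notin> set cs') ?q) = drop (Suc k) ws"
    using Suc.IH[OF cs'] Suc.prems(2) by auto
  have "take T cs' = cs'"
    using length_play[OF cs'] Suc.prems(2) by simp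
  then have c': "x \<in> set (queue cs')" "Some x \<notin> set cs'" if "c = Some x" for x
    using collected_pending[of x cs'] c that by auto
  obtain pre n where pre:
    "queue cs = pre @ duplicate (counter cs') c ?q"
    "map weight pre = take (Suc k) ws"
    "\<And>x. x \<in> set pre \<Longrightarrow> n \<le> fst x \<and> fst x < counter cs"
    "counter cs' \<le> n" "n < counter cs"
  proof (rule state_snoc[of cs' c], goal_cases)
    case (1 pre n)
    then show ?case using that[of pre n] by (simp add: cs)
  qed
  \<comment> \<open>The bound by the old counter covers the latest choice too, which was taken from
    the old queue; the refill starts at \<open>n\<close>, not below that counter.\<close>
  have ids: "fst x < counter cs'" if "Some x \<in> set cs" for x
    using that IH(1)[of x] c'(1)[of x] fst_queue[of x cs'] unfolding cs by auto
  have "map weight (filter (\<lambda>x. Some x \<notin> set cs) (duplicate (counter cs') c ?q)) = drop (Suc k) ws"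
    unfolding cs IH(3)[symmetric]
    using IH(1) c'(2) distinct_queue fst_queue
    by (intro pending_duplicate) (auto dest: in_set_dropD)
  moreover have "Some x \<notin> set cs" if "x \<in> set pre" for x
    using ids[of x] pre(3)[OF that] pre(4) by linarith
  moreover have "fst x < counter cs" if "Some x \<in> set cs" for x
    using ids[OF that] pre(4,5) by linarith
  ultimately show ?case
    using take_drop_queue_snoc[of cs' c pre] pre(1,2) unfolding cs by auto
qed

text \<open>Gain plus pending weight is a potential: at time \<open>T\<close> the pending weight is
  \<open>sum_list ws\<close>, and in the final phase a collected weight only moves from the second
  summand to the first. So the final phase yields the algorithm at most
  \<open>sum_list ws\<close>.\<close>

lemma gain_pending_le:
  assumes "cs \<in> set_pmf (play A (adversary T) (T + L))"
  shows "gain cs + sum_list (map weight (filter (\<lambda>x. Some x \<notin> set cs) (queue (take T cs)))) \<le>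
    gain (take T cs) + sum_list ws"
  using assms
proof (induction L arbitrary: cs)
  case 0
  then have "take T cs = cs" by (auto dest: length_play)
  moreover have "filter (\<lambda>x. Some x \<notin> set cs) (queue cs) =
      take (Suc k) (queue cs) @ filter (\<lambda>x. Some x \<notin> set cs) (drop (Suc k) (queue cs))"
    using play_invariant[of cs T] 0
    by (subst append_take_drop_id[symmetric, of "queue cs" "Suc k"], subst filter_append) auto
  moreover have "sum_list (take (Suc k) ws) + sum_list (drop (Suc k) ws) = sum_list ws"
    by (metis append_take_drop_id sum_list_append)
  ultimately show ?case
    using play_invariant[of cs T] 0 by (simp add: weight_take_queue)
next
  case (Suc L)
  then obtain cs' c where cs: "cs = cs' @ [c]"
    and cs': "cs' \<in> set_pmf (play A (adversary T) (T + L))"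
    and c: "c \<in> set_pmf (A (adv_updates (adversary T) cs') cs')"
    by (auto simp: set_bind_pmf)
  have len: "length cs' = T + L" by (rule length_play[OF cs'])
  let ?P = "filter (\<lambda>x. Some x \<notin> set cs') (queue (take T cs'))"
  show ?case
  proof (cases c)
    case None
    then show ?thesis using Suc.IH[OF cs'] by (simp add: cs len gain_snoc)
  next
    case (Some x)
    have "filter (\<lambda>y. Some y \<notin> set cs) (queue (take T cs')) = filter (\<lambda>y. y \<noteq> x) ?P"
      by (auto simp: cs Some intro!: filter_cong)
    moreover have "x \<in> set ?P"
      using collected_pending[of x cs'] c Some by auto
    ultimately have "sum_list (map weight
          (filter (\<lambda>y. Some y \<notin> set cs) (queue (take T cs')))) + weight x \<le>
        sum_list (map weight ?P)"
      using sum_list_filter_neq_le[of ?P weight x] weight_queue[of _ "take T cs'"] by simp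
    then show ?thesis
      using Suc.IH[OF cs'] by (simp add: cs len gain_snoc Some)
  qed
qed

context
  fixes f :: "real list \<Rightarrow> nat option pmf"
  assumes f_less: "\<And>vs i. Some i \<in> set_pmf (f vs) \<Longrightarrow> i < length vs"
    and A_eq: "\<And>uss cs. A uss cs = map_pmf (map_option (\<lambda>i. pending uss cs ! i))
      (f (map weight (pending uss cs)))"
begin

lemma expectation_step:
  assumes "cs \<in> set_pmf (play A (adversary T) t)" "t \<le> T"
  shows "measure_pmf.expectation (A (adv_updates (adversary T) cs) cs) payoff = alg_rate ws (f ws)"
    and "measure_pmf.expectation (A (adv_updates (adversary T) cs) cs)
      (\<lambda>c. case c of None \<Rightarrow> 0
         | Some x \<Rightarrow> if x \<in> set (drop (Suc k) (queue cs)) then weight x else 0) = duplicate_rate ws k (f ws)"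
proof -
  let ?pre = "take (Suc k) (queue cs)" and ?suf = "drop (Suc k) (queue cs)"
  let ?P = "filter (\<lambda>x. Some x \<notin> set cs) (queue cs)"
  let ?S = "filter (\<lambda>x. Some x \<notin> set cs) ?suf"
  have "take T cs = cs"
    using length_play[OF assms(1)] assms(2) by simp
  then have P: "pending (adv_updates (adversary T) cs) cs = ?P"
    by (simp add: pending_adversary)
  have "?P = filter (\<lambda>x. Some x \<notin> set cs) ?pre @ ?S"
    by (metis append_take_drop_id filter_append)
  also have "filter (\<lambda>x. Some x \<notin> set cs) ?pre = ?pre"
    using play_invariant[OF assms] by simp
  finally have split: "?P = ?pre @ ?S" .
  have w: "map weight ?P = ws"
    using play_invariant[OF assms] unfolding split by (simp add: weight_take_queue)
  have A: "A (adv_updates (adversary T) cs) cs = map_pmf (map_option (\<lambda>i. ?P ! i)) (f ws)"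
    by (simp add: A_eq P w)
  have len: "length ?P = length ws"
    using arg_cong[OF w, of length] by simp
  have weight_nth: "weight (?P ! i) = ws ! i" if "i < length ws" for i
    using that len arg_cong[OF w, of "\<lambda>l. l ! i"] by simp
  \<comment> \<open>The first \<open>Suc k\<close> queue items are all pending, so the pending list
    and the queue agree up to position \<open>k\<close>. The collected originals, which shift
    positions, all lie behind it.\<close>
  have suf: "?P ! i \<in> set ?suf \<longleftrightarrow> k < i" if "i < length ws" for i
  proof (cases "k < i")
    case True
    then have "?P ! i = ?S ! (i - Suc k)" "i - Suc k < length ?S"
      using that len length_queue[of cs] unfolding split by (auto simp: nth_append)
    then have "?P ! i \<in> set ?S" by (metis nth_mem)
    then show ?thesis using True by simp
  next
    case False
    then have "?P ! i = ?pre ! i" "i < length ?pre"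
      using length_queue[of cs] unfolding split by (auto simp: nth_append)
    then have "?P ! i \<in> set ?pre" by (metis nth_mem)
    then have "?P ! i \<notin> set ?suf"
      using set_take_disj_set_drop_if_distinct[OF distinct_queue, of "Suc k" "Suc k" cs] by blast
    then show ?thesis using False by simp
  qed
  show "measure_pmf.expectation (A (adv_updates (adversary T) cs) cs) payoff = alg_rate ws (f ws)"
    unfolding A alg_rate_def integral_map_pmf
    by (intro integral_cong_AE)
      (auto simp: AE_measure_pmf_iff weight_nth dest: f_less split: option.split)
  show "measure_pmf.expectation (A (adv_updates (adversary T) cs) cs)
      (\<lambda>c. case c of None \<Rightarrow> 0
         | Some x \<Rightarrow> if x \<in> set ?suf then weight x else 0) = duplicate_rate ws k (f ws)"
    unfolding A duplicate_rate_def integral_map_pmf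
    by (intro integral_cong_AE)
      (auto simp: AE_measure_pmf_iff weight_nth suf dest: f_less split: option.split)
qed

section \<open>Expected gains of both players\<close>

lemma expectation_gain:
  "measure_pmf.expectation (play A (adversary T) T) gain = real T * alg_rate ws (f ws)"
proof -
  have "measure_pmf.expectation (play A (adversary T) T) gain = gain [] + real T * alg_rate ws (f ws)"
  proof (rule expectation_play_linear[OF online])
    fix t cs
    assume "t < T" "cs \<in> set_pmf (play A (adversary T) t)"
    then show "measure_pmf.expectation (A (adv_updates (adversary T) cs) cs)
        (\<lambda>c. gain (cs @ [c])) = gain cs + alg_rate ws (f ws)"
      using expectation_step(1)[of cs t]
      by (simp add: gain_snoc integrable_measure_pmf_finite finite_set_pmf_online[OF online])
  qed
  then show ?thesis by (simp add: gain_def)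
qed

lemma expectation_queue:
  "measure_pmf.expectation (play A (adversary T) T) (\<lambda>cs. sum_list (map weight (queue cs))) =
     sum_list ws + real T * duplicate_rate ws k (f ws)"
proof -
  have "measure_pmf.expectation (play A (adversary T) T) (\<lambda>cs. sum_list (map weight (queue cs))) =
      sum_list (map weight (queue [])) + real T * duplicate_rate ws k (f ws)"
  proof (rule expectation_play_linear[OF online])
    fix t cs
    assume "t < T" "cs \<in> set_pmf (play A (adversary T) t)"
    then show "measure_pmf.expectation (A (adv_updates (adversary T) cs) cs)
        (\<lambda>c. sum_list (map weight (queue (cs @ [c])))) =
        sum_list (map weight (queue cs)) + duplicate_rate ws k (f ws)"
      unfolding sum_list_queue_snoc using expectation_step(2)[of cs t]
      by (simp add: integrable_measure_pmf_finite finite_set_pmf_online[OF online])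
  qed
  then show ?thesis by (simp add: weight_queue_Nil)
qed

lemma alg_expected_gain_le:
  "alg_expected_gain A (adversary T) (T + L) \<le> real T * alg_rate ws (f ws) + sum_list ws"
proof -
  have "alg_expected_gain A (adversary T) (T + L) \<le>
      measure_pmf.expectation (play A (adversary T) (T + L)) (\<lambda>cs. gain (take T cs) + sum_list ws)"
    unfolding alg_expected_gain_def
  proof (rule integral_mono_AE)
    have "gain cs \<le> gain (take T cs) + sum_list ws"
      if "cs \<in> set_pmf (play A (adversary T) (T + L))" for cs
    proof -
      have "0 \<le> sum_list (map weight (filter (\<lambda>x. Some x \<notin> set cs) (queue (take T cs))))"
        using weight_queue[of _ "take T cs"] by (intro sum_list_nonneg) auto
      then show ?thesis using gain_pending_le[OF that] by linarith
    qed
    then show "AE cs in play A (adversary T) (T + L). gain cs \<le> gain (take T cs) + sum_list ws"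
      by (simp add: AE_measure_pmf_iff)
  qed (auto intro!: integrable_measure_pmf_finite finite_play online)
  also have "\<dots> = measure_pmf.expectation (map_pmf (take T) (play A (adversary T) (T + L))) gain
      + sum_list ws"
    by (simp add: integrable_measure_pmf_finite finite_play online)
  finally show ?thesis
    by (simp add: map_take_play expectation_gain)
qed

text \<open>The lower bound on \<open>L\<close> leaves enough steps to collect the final queue
  completely, so the last summand is its full expected weight.\<close>

lemma adv_expected_gain_eq:
  assumes "length ws + T \<le> L"
  shows "adv_expected_gain A (adversary T) (T + L) =
    real T * ws ! k + (sum_list ws + real T * duplicate_rate ws k (f ws))"
proof -
  have "gain (adv_choices (adversary T) cs) =
      real T * ws ! k + sum_list (map weight (queue (take T cs)))"
    if "cs \<in> set_pmf (play A (adversary T) (T + L))" for cs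
  proof -
    have len: "length cs = T + L" by (rule length_play[OF that])
    then have "length (queue (take T cs)) \<le> L"
      using length_queue_le[of "take T cs"] assms by simp
    then show ?thesis by (simp add: gain_adv_choices len)
  qed
  then have "adv_expected_gain A (adversary T) (T + L) =
      measure_pmf.expectation (play A (adversary T) (T + L))
        (\<lambda>cs. real T * ws ! k + sum_list (map weight (queue (take T cs))))"
    unfolding adv_expected_gain_def
    by (intro integral_cong_AE) (auto simp: AE_measure_pmf_iff)
  also have "\<dots> = real T * ws ! k + measure_pmf.expectation
      (map_pmf (take T) (play A (adversary T) (T + L))) (\<lambda>cs. sum_list (map weight (queue cs)))"
    by (simp add: integrable_measure_pmf_finite finite_play online)
  finally show ?thesis
    by (simp add: map_take_play expectation_queue)
qed

end

end

lemma competitive_rate: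
  fixes A :: algorithm
  assumes "online_algorithm A"
    and f: "\<And>vs i. Some i \<in> set_pmf (f vs) \<Longrightarrow> i < length vs"
      "\<And>uss cs. A uss cs = map_pmf (map_option (\<lambda>i. pending uss cs ! i))
        (f (map weight (pending uss cs)))"
    and "0 < R" "competitive R A"
  shows "ws ! k + duplicate_rate ws k (f ws) \<le> R * alg_rate ws (f ws)"
proof (rule ccontr)
  let ?D = "duplicate_rate ws k (f ws)" and ?G = "alg_rate ws (f ws)"
  assume "\<not> ?thesis"
  then have "0 < ws ! k + ?D - R * ?G"
    by simp
  \<comment> \<open>If the inequality fails, the adversary has a fixed positive advantage per step.
    Enough steps outweigh \<open>R * sum_list ws\<close>, the contribution of the algorithm's
    possible gain in the final phase.\<close>
  then obtain T where T: "R * sum_list ws < real T * (ws ! k + ?D - R * ?G)"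
    using ex_less_of_nat_mult by blast
  have "0 \<le> sum_list ws"
    using nonneg by (intro sum_list_nonneg)
  have "adv_expected_gain A (adversary T) (T + (length ws + T)) \<le>
      R * alg_expected_gain A (adversary T) (T + (length ws + T))"
    using assms(4,5) adaptive_online_adversary[of T]
    unfolding competitive_def by (auto simp: field_simps)
  also have "\<dots> \<le> R * (real T * ?G + sum_list ws)"
    using alg_expected_gain_le[OF assms(1) f] assms(4) by (intro mult_left_mono) auto
  finally have "real T * ws ! k + (sum_list ws + real T * ?D) \<le> R * (real T * ?G + sum_list ws)"
    using adv_expected_gain_eq[OF assms(1) f, of T "length ws + T"] by simp
  then show False
    using T \<open>0 \<le> sum_list ws\<close> by (simp add: algebra_simps)
qed

end

lemma competitive_ge:
  fixes A :: algorithm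
  assumes "online_algorithm A" "memoryless A" "0 < R" "competitive R A" and n: "2 \<le> n"
  shows "1 \<le> R * (1 - (1 - 1 / real n) ^ n)"
proof -
  obtain f :: "real list \<Rightarrow> nat option pmf" where
    f: "\<And>vs i. Some i \<in> set_pmf (f vs) \<Longrightarrow> i < length vs"
      "\<And>uss cs. A uss cs = map_pmf (map_option (\<lambda>i. pending uss cs ! i))
        (f (map weight (pending uss cs)))"
    using assms(2) unfolding memoryless_def by blast
  \<comment> \<open>This choice makes \<open>1 - b\<close> equal to \<open>1 / n\<close>, so the
    coefficients \<open>b ^ k / n\<close> telescope; \<open>n \<ge> 2\<close> keeps \<open>b\<close>
    positive.\<close>
  define b where "b = 1 - 1 / real n"
  have b: "0 < b" "1 - b = 1 / real n"
    using n by (auto simp: b_def)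
  define w where "w i = inverse b ^ i" for i
  have w: "b ^ i * w i = 1" "0 \<le> w i" for i
    using b by (auto simp: w_def field_simps)
  define ws where "ws = map w [0..<Suc n]"
  have ws_nth: "ws ! i = w i" if "i \<le> n" for i
    using that by (simp add: ws_def del: upt_Suc)
  have geometric: "(\<Sum>k<i. b ^ k / real n) = 1 - b ^ i" for i
    using one_diff_power_eq[of b i] b by (simp add: sum_distrib_left)
  define q where "q k j = (case j of None \<Rightarrow> 0 | Some i \<Rightarrow> if k < i then ws ! i else 0)"
    for k j
  define g where "g j = (case j of None \<Rightarrow> 0 | Some i \<Rightarrow> ws ! i)" for j
  let ?E = "measure_pmf.expectation (f ws)"
  have rate: "w k + ?E (q k) \<le> R * ?E g" if "k < n" for k
  proof -
    interpret duplication ws k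
      by standard (use that w in \<open>auto simp: ws_def\<close>)
    show ?thesis
      using competitive_rate[OF assms(1) f assms(3,4)] ws_nth[of k] that
      by (simp add: duplicate_rate_def alg_rate_def q_def[abs_def] g_def[abs_def])
  qed
  have fin: "finite (set_pmf (f ws))"
  proof (rule finite_subset)
    show "set_pmf (f ws) \<subseteq> insert None (Some ` {..<length ws})"
    proof
      fix j assume "j \<in> set_pmf (f ws)"
      then show "j \<in> insert None (Some ` {..<length ws})"
        by (cases j) (auto dest: f(1))
    qed
  qed simp
  \<comment> \<open>The combination is checked for each single outcome \<open>j\<close>, which
    avoids handling the probabilities. It is an equality for every \<open>Some i\<close>, by the
    geometric sum and \<open>b ^ i * w i = 1\<close>; for \<open>None\<close> it reads
    \<open>0 \<le> 1\<close>.\<close>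
  have pointwise: "g j \<le> 1 + (\<Sum>k<n. b ^ k / real n * q k j)" if "j \<in> set_pmf (f ws)" for j
  proof (cases j)
    case None
    then show ?thesis by (simp add: g_def q_def)
  next
    case (Some i)
    have i: "i \<le> n"
      using f(1) that Some by (fastforce simp: ws_def)
    have "(\<Sum>k<n. b ^ k / real n * q k j) = (\<Sum>k<i. b ^ k / real n * w i)"
      using i by (intro sum.mono_neutral_cong_right) (auto simp: q_def Some ws_nth)
    also have "\<dots> = (1 - b ^ i) * w i"
      by (simp only: sum_distrib_right[symmetric] geometric)
    also have "\<dots> = w i - 1"
      using w(1)[of i] by (simp add: algebra_simps)
    finally show ?thesis by (simp add: g_def Some ws_nth i)
  qed
  have "?E g \<le> ?E (\<lambda>j. 1 + (\<Sum>k<n. b ^ k / real n * q k j))"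
    using pointwise by (intro integral_mono_AE)
      (auto simp: AE_measure_pmf_iff intro!: integrable_measure_pmf_finite fin)
  also have "\<dots> = 1 + (\<Sum>k<n. b ^ k / real n * ?E (q k))"
    by (simp add: integrable_measure_pmf_finite fin integral_sum)
  \<comment> \<open>The constant 1 is the sum of \<open>n\<close> terms
    \<open>b ^ k / n * w k = 1 / n\<close>, the adversary's weighted gains at position
    \<open>k\<close>.\<close>
  also have "\<dots> = (\<Sum>k<n. b ^ k / real n * (w k + ?E (q k)))"
    using w(1) n by (simp add: algebra_simps sum.distrib)
  also have "\<dots> \<le> (\<Sum>k<n. b ^ k / real n * (R * ?E g))"
    using rate b by (intro sum_mono mult_left_mono) auto
  also have "\<dots> = (1 - b ^ n) * (R * ?E g)"
    by (simp only: sum_distrib_right[symmetric] geometric)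
  finally have le: "1 * ?E g \<le> (R * (1 - b ^ n)) * ?E g"
    by (simp add: algebra_simps)
  \<comment> \<open>To cancel \<open>?E g\<close> it must be positive: for \<open>k = 0\<close> the
    adversary gains at least \<open>w 0 = 1\<close> per step, hence
    \<open>R * ?E g \<ge> 1\<close>.\<close>
  have "0 \<le> ?E (q 0)"
    using w by (intro integral_nonneg_AE)
      (auto simp: AE_measure_pmf_iff q_def ws_nth ws_def dest!: f(1) split: option.split simp del: upt_Suc)
  then have "0 < R * ?E g"
    using rate[of 0] n w(1)[of 0] by simp
  then have "0 < ?E g"
    using assms(3) by (simp add: zero_less_mult_iff)
  then show ?thesis
    using le unfolding b_def by simp
qed

theorem theorem9:
  fixes A :: algorithm
  assumes "online_algorithm A" and "memoryless A"
  shows "competitive_ratio A \<ge> ereal (exp 1 / (exp 1 - 1))"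
  unfolding competitive_ratio_def
proof (rule Inf_greatest)
  fix r assume "r \<in> {ereal R |R. 0 < R \<and> competitive R A}"
  then obtain R where R: "r = ereal R" "0 < R" "competitive R A" by blast
  \<comment> \<open>The base is written as \<open>1 + (-1) / n\<close> to match the standard limit
    for \<open>exp (-1)\<close>.\<close>
  have "(\<lambda>n. R * (1 - (1 + (-1) / real n) ^ n)) \<longlonglongrightarrow> R * (1 - exp (-1))"
    by (intro tendsto_intros tendsto_exp_limit_sequentially)
  moreover have "\<forall>\<^sub>F n in sequentially. 1 \<le> R * (1 - (1 + (-1) / real n) ^ n)"
    using eventually_ge_at_top[of 2] by eventually_elim (use competitive_ge[OF assms R(2,3)] in simp)
  ultimately have "1 \<le> R * (1 - exp (-1))"
    by (intro tendsto_lowerbound) auto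
  then have "exp 1 \<le> R * (exp 1 - 1)"
    by (simp add: exp_minus field_simps)
  then show "ereal (exp 1 / (exp 1 - 1)) \<le> r"
    by (simp add: R(1) divide_le_eq)
qed

end
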